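(* Let $n\ge 2$ be even and let $0\le p\le n/2$. The number $a_{n,p}$ of perfect matchings with $z$-weight $n_z=n/2-p$ and $w$-weight $n_w=0$ on the strip of hexagons with $n$ black nodes on the torus is $$a_{n,p}=\frac{n}{n-p}\binom{n-p}{p},$$ and for $p\ge 1$ this also equals $\dfrac{n}{p!}\prod_{q=1}^{p-1}(n-p-q)$.
   Context: Strip of squares. For even $n\ge2$, the strip of squares $\mathcal G_{2,n}$ on the torus is the multigraph with $2n$ nodes $(r,j)$, $r\in\mathbb Z/2$ (row; $r=0$ bottom, $r=1$ top), $j\in\mathbb Z/n$ (column). Node $(r,j)$ is black if $r+j$ is even and white otherwise, so there are $n$ black nodes. There are $4n$ distinct edges (parallel edges count as different): horizontal edges $h_{r,j}$ joining $(r,j)$ and $(r,j+1)$, and vertical edges $v_{r,j}$ joining $(r,j)$ and $(r+1,j)$, where $v_{r,j}$ is thought of as going upwards from $(r,j)$; thus $v_{0,j}$ is internal and $v_{1,j}$ crosses the cycle $z$ of the torus. Strip of hexagons. It is obtained from $\mathcal G_{2,n}$ by deleting half of the vertical edges, namely all $v_{r,j}$ with $(r,j)$ white; so each black node keeps its left, right and up edges. Weights. A perfect matching is a set of edges touching each node exactly once. Edges are directed from black to white. The $z$-weight $n_z$ of a matching $M$ is the sum over edges $v_{1,j}\in M$ of $+1$ if $(1,j)$ is black and $-1$ if $(1,j)$ is white. The $w$-weight $n_w$ of $M$ is the sum over edges $h_{r,n-1}\in M$ (those crossing the cycle $w$) of $+1$ if $(r,n-1)$ is black and $-1$ if $(r,n-1)$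 is white. *)

theory Defs
  imports Complex_Main
begin

text \<open>
  Residue classes are represented by their least representatives: a node \<open>(r, j)\<close> has row
  \<open>r < 2\<close> (bottom 0, top 1) and column \<open>j < n\<close>. Since \<open>n\<close> is even, the colour of a node does not
  depend on the choice of representatives.
\<close>

type_synonym node = "nat \<times> nat"

definition nodes :: "nat \<Rightarrow> node set" where
  "nodes n = {..<2} \<times> {..<n}"

fun black :: "node \<Rightarrow> bool" where
  "black (r, j) \<longleftrightarrow> even (r + j)"

text \<open>
  Edges are named rather than identified with their sets of endpoints, so that parallel edges
  (\<open>Vert 0 j\<close> and \<open>Vert 1 j\<close>, or \<open>Horiz r 0\<close> and \<open>Horiz r 1\<close> if \<open>n = 2\<close>) stay distinct.
\<close>

datatype edge = Horiz nat nat | Vert nat nat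

primrec ends :: "nat \<Rightarrow> edge \<Rightarrow> node set" where
  "ends n (Horiz r j) = {(r, j), (r, (j + 1) mod n)}"
| "ends n (Vert r j) = {(r, j), ((r + 1) mod 2, j)}"

definition squares_edges :: "nat \<Rightarrow> edge set" where
  "squares_edges n = {Horiz r j |r j. (r, j) \<in> nodes n} \<union> {Vert r j |r j. (r, j) \<in> nodes n}"

definition hexagons_edges :: "nat \<Rightarrow> edge set" where
  "hexagons_edges n = squares_edges n - {Vert r j |r j. \<not> black (r, j)}"

definition perfect_matching :: "nat \<Rightarrow> edge set \<Rightarrow> edge set \<Rightarrow> bool" where
  "perfect_matching n E M \<longleftrightarrow> M \<subseteq> E \<and> (\<forall>v\<in>nodes n. \<exists>!e. e \<in> M \<and> v \<in> ends n e)"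

text \<open>
  \<open>Horiz r j\<close> leaves \<open>(r, j)\<close> to the right and \<open>Vert r j\<close> leaves it upwards. As edges are directed
  from black to white, an edge is traversed in this sense iff \<open>(r, j)\<close> is black.
\<close>

definition direction :: "node \<Rightarrow> int" where
  "direction v = (if black v then 1 else -1)"

definition z_weight :: "edge set \<Rightarrow> int" where
  "z_weight M = (\<Sum>j | Vert 1 j \<in> M. direction (1, j))"

definition w_weight :: "nat \<Rightarrow> edge set \<Rightarrow> int" where
  "w_weight n M = (\<Sum>r | Horiz r (n - 1) \<in> M. direction (r, n - 1))"

definition hexagon_matchings :: "nat \<Rightarrow> int \<Rightarrow> int \<Rightarrow> edge set set" where
  "hexagon_matchings n nz nw =
     {M. perfect_matching n (hexagons_edges n) M \<and> z_weight M = nz \<and> w_weight n M = nw}"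

end

theory Submission
  imports Defs
begin

text \<open>
  Every column carries exactly one vertical edge, so at each node of a column the matching uses the
  vertical edge of the column, the horizontal edge to the left or the one to the right. If \<open>n\<^sub>w = 0\<close>,
  the two rows agree on the edges crossing \<open>w\<close>, hence, going from column to column, on all
  horizontal edges. The matching is thus determined by the set \<open>T\<close> of columns from which a
  horizontal edge leaves to the right, and \<open>T\<close> is an arbitrary set without cyclically consecutive
  elements. Each element of \<open>T\<close> blocks the vertical edge of one odd column, so that
  \<open>n\<^sub>z = n / 2 - card T\<close>, and the sets \<open>T\<close> of given size are counted by splitting on \<open>n - 1 \<in> T\<close>.
\<close>

section \<open>Sets without consecutive elements\<close>

text \<open>On an interval \<open>A\<close> these are the independent sets of size \<open>p\<close>
  of a path; \<open>cyclic_sparse_sets\<close> gives those of a cycle on \<open>n\<close>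
  vertices.\<close>

definition sparse_sets :: "nat set \<Rightarrow> nat \<Rightarrow> nat set set" where
  "sparse_sets A p = {T. T \<subseteq> A \<and> card T = p \<and> (\<forall>j\<in>T. Suc j \<notin> T)}"

definition cyclic_sparse_sets :: "nat \<Rightarrow> nat \<Rightarrow> nat set set" where
  "cyclic_sparse_sets n p = {T. T \<subseteq> {..<n} \<and> card T = p \<and> (\<forall>j\<in>T. Suc j mod n \<notin> T)}"

lemma finite_sparse_sets: "finite A \<Longrightarrow> finite (sparse_sets A p)"
  unfolding sparse_sets_def by (rule finite_subset[of _ "Pow A"]) auto

lemma sparse_sets_0: "finite A \<Longrightarrow> sparse_sets A 0 = {{}}"
  unfolding sparse_sets_def by (auto dest: finite_subset)

text \<open>Serves both recurrences below, which sort sets by whether they contain \<open>x\<close>.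
  Membership of \<open>x\<close> separates the two families, and inserting \<open>x\<close> is
  injective on sets that avoid it.\<close>

lemma card_Un_insert_image:
  assumes "finite F" "finite G" "\<And>T. T \<in> F \<Longrightarrow> x \<notin> T" "\<And>T. T \<in> G \<Longrightarrow> x \<notin> T"
  shows "card (F \<union> insert x ` G) = card F + card G"
proof -
  have "inj_on (insert x) G"
    using assms(4) by (intro inj_onI) (metis insert_ident)
  then show ?thesis
    using assms by (subst card_Un_disjoint) (auto simp: card_image)
qed

text \<open>A set containing the last point \<open>a + Suc m\<close> must avoid its neighbour
  \<open>a + m\<close>, so the rest of it lies in an interval shorter by two; otherwise only the
  last point is lost.\<close>

lemma sparse_sets_split:
  "sparse_sets {a..<a + Suc (Suc m)} (Suc p) =
     sparse_sets {a..<a + Suc m} (Suc p) \<union> insert (a + Suc m) ` sparse_sets {a..<a + m} p"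
  (is "?L = ?F \<union> insert ?x ` ?G")
proof (intro equalityI subsetI)
  fix T assume T: "T \<in> ?L"
  then have fin: "finite T" and sub: "T \<subseteq> {a..<a + Suc (Suc m)}"
    by (auto simp: sparse_sets_def intro: finite_subset)
  show "T \<in> ?F \<union> insert ?x ` ?G"
  proof (cases "?x \<in> T")
    case True
    then have "a + m \<notin> T" using T by (auto simp: sparse_sets_def)
    have "T - {?x} \<subseteq> {a..<a + m}"
    proof
      fix y assume y: "y \<in> T - {?x}"
      with \<open>a + m \<notin> T\<close> have "y \<noteq> a + m" by auto
      with y sub show "y \<in> {a..<a + m}" by fastforce
    qed
    then have "T - {?x} \<in> ?G" "T = insert ?x (T - {?x})"
      using True T fin by (auto simp: sparse_sets_def)
    then show ?thesis by blast
  next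
    case False
    have "T \<subseteq> {a..<a + Suc m}"
    proof
      fix y assume "y \<in> T"
      with False have "y \<noteq> ?x" by auto
      with \<open>y \<in> T\<close> sub show "y \<in> {a..<a + Suc m}" by fastforce
    qed
    then show ?thesis using T by (auto simp: sparse_sets_def)
  qed
next
  fix T assume "T \<in> ?F \<union> insert ?x ` ?G"
  then consider "T \<in> ?F" | S where "S \<in> ?G" "T = insert ?x S" by blast
  then show "T \<in> ?L"
  proof cases
    case 1
    then show ?thesis by (fastforce simp: sparse_sets_def)
  next
    case 2
    then have S: "S \<subseteq> {a..<a + m}" "card S = p" "\<forall>j\<in>S. Suc j \<notin> S"
      by (auto simp: sparse_sets_def)
    then have "?x \<notin> S" "Suc ?x \<notin> S" "finite S" "\<forall>j\<in>S. Suc j \<noteq> ?x"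
      by (auto intro: finite_subset)
    then show ?thesis using S 2(2) by (fastforce simp: sparse_sets_def)
  qed
qed

lemma card_sparse_sets: "card (sparse_sets {a..<a + m} p) = (m + 1 - p) choose p"
proof (induction m arbitrary: p rule: induct_nat_012)
  case 0
  have "sparse_sets {a..<a + 0} p = (if p = 0 then {{}} else {})"
    by (auto simp: sparse_sets_def)
  then show ?case by (cases p) auto
next
  case 1
  have "sparse_sets {a..<a + Suc 0} p = (if p = 0 then {{}} else if p = 1 then {{a}} else {})"
    by (auto simp: sparse_sets_def subset_singleton_iff)
  then show ?case by (cases p) (auto simp: not_less)
next
  case (ge2 m)
  show ?case
  proof (cases p)
    case 0
    then show ?thesis by (simp add: sparse_sets_0)
  next
    case (Suc q)
    have "card (sparse_sets {a..<a + Suc (Suc m)} (Suc q)) =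
            card (sparse_sets {a..<a + Suc m} (Suc q)) + card (sparse_sets {a..<a + m} q)"
      unfolding sparse_sets_split
      by (rule card_Un_insert_image)
         (auto simp: finite_sparse_sets, auto simp: sparse_sets_def)
    also have "\<dots> = ((Suc m + 1 - Suc q) choose Suc q) + ((m + 1 - q) choose q)"
      by (simp only: ge2)
    \<comment> \<open>Pascal's rule if \<open>q \<le> m + 1\<close>; otherwise every upper index
      truncates to 0 and both sides vanish.\<close>
    also have "\<dots> = (Suc (Suc m) + 1 - Suc q) choose Suc q"
      by (cases "q \<le> m + 1") (auto simp: Suc_diff_le)
    finally show ?thesis using Suc by simp
  qed
qed

text \<open>Cutting the cycle at \<open>n - 1\<close> leaves paths: if \<open>n - 1\<close> is
  absent, the path on all other points; if it is present, both its neighbours 0 and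
  \<open>n - 2\<close> are excluded as well.\<close>

lemma cyclic_sparse_sets_split:
  assumes "n \<ge> 2"
  shows "cyclic_sparse_sets n (Suc p) =
           sparse_sets {0..<n - 1} (Suc p) \<union> insert (n - 1) ` sparse_sets {1..<n - 2} p"
    (is "?L = ?F \<union> insert ?x ` ?G")
proof (intro equalityI subsetI)
  fix T assume T: "T \<in> ?L"
  then have fin: "finite T" and sub: "\<And>j. j \<in> T \<Longrightarrow> j < n"
    and cyc: "\<And>j. j \<in> T \<Longrightarrow> Suc j mod n \<notin> T"
    by (auto simp: cyclic_sparse_sets_def intro: finite_subset)
  have path: "Suc j \<notin> T" if "j \<in> T" for j
    using sub[of "Suc j"] cyc[OF that] by auto
  show "T \<in> ?F \<union> insert ?x ` ?G"
  proof (cases "?x \<in> T")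
    case True
    then have "0 \<notin> T" "n - 2 \<notin> T"
      using cyc[of ?x] path[of "n - 2"] assms by (auto simp: Suc_diff_Suc numeral_2_eq_2)
    have "T - {?x} \<subseteq> {1..<n - 2}"
    proof
      fix y assume y: "y \<in> T - {?x}"
      then have "y \<in> T" "y \<noteq> n - 1" by auto
      moreover from this have "y \<noteq> 0" "y \<noteq> n - 2" "y < n"
        using \<open>0 \<notin> T\<close> \<open>n - 2 \<notin> T\<close> sub by metis+
      ultimately show "y \<in> {1..<n - 2}" by auto
    qed
    then have "T - {?x} \<in> ?G" "T = insert ?x (T - {?x})"
      using True T fin path by (auto simp: sparse_sets_def cyclic_sparse_sets_def)
    then show ?thesis by blast
  next
    case False
    have "T \<subseteq> {0..<n - 1}"
    proof
      fix y assume "y \<in> T"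
      then have "y \<noteq> n - 1" "y < n" using False sub by auto
      then show "y \<in> {0..<n - 1}" by auto
    qed
    then show ?thesis using T path by (auto simp: sparse_sets_def cyclic_sparse_sets_def)
  qed
next
  fix T assume "T \<in> ?F \<union> insert ?x ` ?G"
  then consider "T \<in> ?F" | S where "S \<in> ?G" "T = insert ?x S" by blast
  then show "T \<in> ?L"
  proof cases
    case 1
    then have sub: "\<And>j. j \<in> T \<Longrightarrow> j < n - 1" by (auto simp: sparse_sets_def)
    then have "\<And>j. j \<in> T \<Longrightarrow> Suc j mod n = Suc j" "\<And>j. j \<in> T \<Longrightarrow> j < n"
      by (fastforce intro: mod_less)+
    then show ?thesis using 1 by (auto simp: sparse_sets_def cyclic_sparse_sets_def)
  next
    case 2
    then have S: "\<And>j. j \<in> S \<Longrightarrow> 1 \<le> j \<and> j < n - 2" "card S = p" "\<And>j. j \<in> S \<Longrightarrow> Suc j \<notin> S"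
      "finite S"
      by (auto simp: sparse_sets_def intro: finite_subset)
    then have "?x \<notin> S" "0 \<notin> S" by fastforce+
    moreover have "Suc j mod n = Suc j" "j < n" "Suc j \<noteq> n - 1" if "j \<in> S" for j
      using S(1)[OF that] by auto
    ultimately show ?thesis using S 2(2) assms by (auto simp: cyclic_sparse_sets_def)
  qed
qed

lemma card_cyclic_sparse_sets:
  assumes "n \<ge> 2" "p \<le> n div 2"
  shows "real (card (cyclic_sparse_sets n p)) = real n / (real n - real p) * real ((n - p) choose p)"
proof (cases p)
  case 0
  have "cyclic_sparse_sets n 0 = {{}}"
    by (auto simp: cyclic_sparse_sets_def dest: finite_subset)
  then show ?thesis using 0 assms by simp
next
  case (Suc q)
  \<comment> \<open>Chosen so that \<open>n - p = Suc m\<close>, which puts the two binomials into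
    the shape of the absorption identity.\<close>
  define m where "m = n - Suc p"
  have n: "n = Suc (m + p)" using assms Suc by (auto simp: m_def)
  have "card (cyclic_sparse_sets n p) =
          card (sparse_sets {0..<n - 1} p) + card (sparse_sets {1..<n - 2} q)"
    unfolding Suc cyclic_sparse_sets_split[OF assms(1)]
    by (rule card_Un_insert_image)
       (simp_all add: finite_sparse_sets, auto simp: sparse_sets_def subset_iff)
  also have "card (sparse_sets {0..<n - 1} p) = Suc m choose p"
    using card_sparse_sets[of 0 "n - 1" p] n by simp
  also have "card (sparse_sets {1..<n - 2} q) = m choose q"
  \<comment> \<open>For \<open>n = 2\<close> the subtraction \<open>n - 3\<close> truncates and
    cannot serve as the interval length; the interval is empty then, and
    \<open>q = 0\<close>.\<close>
  proof (cases "n = 2")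
    case True
    then show ?thesis using card_sparse_sets[of 1 0 q] assms Suc n by simp
  next
    case False
    then have *: "1 + (n - 3) = n - 2" "n - 3 + 1 - q = m" using n Suc assms by auto
    show ?thesis using card_sparse_sets[of 1 "n - 3" q] unfolding * .
  qed
  finally have card: "card (cyclic_sparse_sets n p) = (Suc m choose p) + (m choose q)" .
  \<comment> \<open>Absorption: the second binomial is p/(n - p) times the first, so the sum is (1 +
    p/(n - p)) = n/(n - p) times the first.\<close>
  have "Suc m * (m choose q) = p * (Suc m choose p)"
    unfolding Suc by (metis Suc_times_binomial_eq mult.commute)
  then have "real (Suc m) * real (m choose q) = real p * real (Suc m choose p)"
    by (metis of_nat_mult)
  then have "real (m choose q) = real p * real (Suc m choose p) / real (Suc m)"
    by (simp add: field_simps)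
  moreover have "real n - real p = real (Suc m)" "n - p = Suc m" "real n = real (Suc m) + real p"
    using n by auto
  ultimately show ?thesis
    unfolding card of_nat_add by (simp add: add_divide_distrib distrib_right)
qed

section \<open>Perfect matchings as sets of columns\<close>

text \<open>The inverse of \<open>Suc j mod n\<close> on the columns. Column 0 is treated separately
  because truncated subtraction would fix it instead of wrapping around.\<close>

definition previous :: "nat \<Rightarrow> nat \<Rightarrow> nat" where
  "previous n j = (if j = 0 then n - 1 else j - 1)"

text \<open>Row \<open>j mod 2\<close> holds the black node of column \<open>j\<close>, the one that
  keeps its up edge. That edge is taken exactly when no chosen horizontal edge reaches the column
  from either side.\<close>

definition parallel_matching :: "nat \<Rightarrow> nat set \<Rightarrow> edge set" where
  "parallel_matching n T = {Horiz r j |r j. r < 2 \<and> j \<in> T} \<union>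
     {Vert (j mod 2) j |j. j < n \<and> j \<notin> T \<and> previous n j \<notin> T}"

lemma parallel_matching_simps [simp]:
  "Horiz r j \<in> parallel_matching n T \<longleftrightarrow> r < 2 \<and> j \<in> T"
  "Vert r j \<in> parallel_matching n T \<longleftrightarrow> r = j mod 2 \<and> j < n \<and> j \<notin> T \<and> previous n j \<notin> T"
  by (auto simp: parallel_matching_def)

lemma Suc_mod_eq_iff_previous:
  assumes "i < n" "j < n"
  shows "Suc i mod n = j \<longleftrightarrow> i = previous n j"
  using assms by (cases "Suc i = n") (auto simp: previous_def)

lemma previous_neq: "n \<ge> 2 \<Longrightarrow> previous n j \<noteq> j"
  by (auto simp: previous_def)

section \<open>Perfect matchings as equations at the nodes\<close>

lemma hexagons_edges_simps [simp]:
  "Horiz r j \<in> hexagons_edges n \<longleftrightarrow> r < 2 \<and> j < n"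
  "Vert r j \<in> hexagons_edges n \<longleftrightarrow> r = j mod 2 \<and> j < n"
proof -
  have "even (r + j) \<longleftrightarrow> r = j mod 2" if "r < 2"
    using that by (cases "r = 0") (auto simp: less_2_cases_iff mod_2_eq_odd)
  then show "Vert r j \<in> hexagons_edges n \<longleftrightarrow> r = j mod 2 \<and> j < n"
    by (auto simp: hexagons_edges_def squares_edges_def nodes_def)
qed (auto simp: hexagons_edges_def squares_edges_def nodes_def)

lemma incident_edge_iff:
  assumes "n \<ge> 2" "r < 2" "j < n" "e \<in> hexagons_edges n"
  shows "(r, j) \<in> ends n e \<longleftrightarrow> e \<in> {Horiz r j, Horiz r (previous n j), Vert (j mod 2) j}"
proof (cases e)
  case (Horiz s i)
  then show ?thesis using assms Suc_mod_eq_iff_previous[of i n j] by auto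
next
  case (Vert s i)
  then show ?thesis using assms by (auto simp: less_2_cases_iff mod_2_eq_odd)
qed

text \<open>Each node has three distinct incident edges (two of them parallel if
  \<open>n = 2\<close>), so uniqueness of the matching edge becomes a sum of indicators. Both nodes
  of a column share the vertical term, which is what links the rows.\<close>

lemma perfect_matching_hexagons_iff:
  assumes "n \<ge> 2"
  shows "perfect_matching n (hexagons_edges n) M \<longleftrightarrow> M \<subseteq> hexagons_edges n \<and>
    (\<forall>r<2. \<forall>j<n. of_bool (Horiz r j \<in> M) + of_bool (Horiz r (previous n j) \<in> M)
                  + of_bool (Vert (j mod 2) j \<in> M) = (1::nat))"
proof -
  have key: "(\<exists>!e. e \<in> M \<and> (r, j) \<in> ends n e) \<longleftrightarrow>
      of_bool (Horiz r j \<in> M) + of_bool (Horiz r (previous n j) \<in> M)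
        + of_bool (Vert (j mod 2) j \<in> M) = (1::nat)"
    if "M \<subseteq> hexagons_edges n" "r < 2" "j < n" for r j
  proof -
    have "e \<in> M \<and> (r, j) \<in> ends n e \<longleftrightarrow>
        e \<in> M \<and> e \<in> {Horiz r j, Horiz r (previous n j), Vert (j mod 2) j}" for e
      using incident_edge_iff[OF assms that(2,3)] that(1) by blast
    moreover have "Horiz r j \<noteq> Horiz r (previous n j)"
      using previous_neq[OF assms, of j] by auto
    ultimately show ?thesis by (auto simp: of_bool_def)
  qed
  have nodes: "(\<forall>v\<in>nodes n. P v) \<longleftrightarrow> (\<forall>r<2. \<forall>j<n. P (r, j))" for P
    by (auto simp: nodes_def)
  show ?thesis
    unfolding perfect_matching_def nodes using key by blast
qed

section \<open>The weights and the agreement of the rows\<close>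

lemma w_weight_eq_0_iff:
  assumes "n \<ge> 2" "even n" "M \<subseteq> hexagons_edges n"
  shows "w_weight n M = 0 \<longleftrightarrow> (Horiz 0 (n - 1) \<in> M \<longleftrightarrow> Horiz 1 (n - 1) \<in> M)"
proof -
  have "{r. Horiz r (n - 1) \<in> M} = {r \<in> {0, 1}. Horiz r (n - 1) \<in> M}"
    using assms(3) by (auto simp: less_2_cases_iff)
  then have "w_weight n M = (\<Sum>r\<in>{0, 1}. if Horiz r (n - 1) \<in> M then direction (r, n - 1) else 0)"
    unfolding w_weight_def by (simp only: sum.inter_filter finite.intros)
  \<comment> \<open>As \<open>n - 1\<close> is odd, the crossing edge of row 0 counts -1 and that of
    row 1 counts +1.\<close>
  then show ?thesis
    using assms(1,2) by (auto simp: direction_def)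
qed

lemma sum_lessThan_double: "(\<Sum>i<2 * m. f i) = (\<Sum>k<m. f (2 * k) + f (2 * k + 1 :: nat))"
  for f :: "nat \<Rightarrow> 'a::comm_monoid_add"
  by (induction m) (auto simp: add.assoc)

text \<open>Edges \<open>Vert 1 j\<close> exist only in odd columns and count +1. At the bottom node
  of column \<open>2 * k + 1\<close> such an edge is absent exactly when one of the bottom edges
  from \<open>2 * k\<close> and \<open>2 * k + 1\<close> is used; over all \<open>k\<close> these
  run through the bottom row once.\<close>

lemma z_weight_hexagons:
  assumes "n \<ge> 2" "even n" and M: "perfect_matching n (hexagons_edges n) M"
  shows "z_weight M = int (n div 2) - int (card {j. Horiz 0 j \<in> M})"
proof -
  define m where "m = n div 2"
  have n: "n = 2 * m" using assms by (simp add: m_def)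
  have sub: "M \<subseteq> hexagons_edges n"
    and one: "\<And>j. j < n \<Longrightarrow> of_bool (Horiz 0 j \<in> M) + of_bool (Horiz 0 (previous n j) \<in> M)
                  + of_bool (Vert (j mod 2) j \<in> M) = (1::nat)"
    using M unfolding perfect_matching_hexagons_iff[OF assms(1)] by simp_all
  have vert: "j < n \<and> odd j" if "Vert 1 j \<in> M" for j
    using that sub by (auto simp: odd_iff_mod_2_eq_one dest!: subsetD)
  have "z_weight M = (\<Sum>j | j \<in> {..<n} \<and> Vert 1 j \<in> M. direction (1, j))"
    unfolding z_weight_def by (rule sum.cong) (use vert in auto)
  also have "\<dots> = (\<Sum>j<n. if Vert 1 j \<in> M then direction (1, j) else 0)"
    by (rule sum.inter_filter) auto
  also have "\<dots> = (\<Sum>j<2 * m. of_bool (Vert 1 j \<in> M))"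
    unfolding n by (rule sum.cong) (use vert in \<open>auto simp: direction_def\<close>)
  also have "\<dots> = (\<Sum>k<m. of_bool (Vert 1 (2 * k) \<in> M) + of_bool (Vert 1 (2 * k + 1) \<in> M))"
    by (rule sum_lessThan_double)
  also have "\<dots> = (\<Sum>k<m. 1 - (of_bool (Horiz 0 (2 * k) \<in> M) + of_bool (Horiz 0 (2 * k + 1) \<in> M)))"
  proof (rule sum.cong)
    fix k assume "k \<in> {..<m}"
    then have "2 * k + 1 < n" using n by auto
    from one[OF this] have "of_bool (Horiz 0 (2 * k + 1) \<in> M) + of_bool (Horiz 0 (2 * k) \<in> M)
        + of_bool (Vert 1 (2 * k + 1) \<in> M) = (1::nat)"
      by (simp add: previous_def)
    moreover have "Vert 1 (2 * k) \<notin> M" using vert[of "2 * k"] by auto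
    ultimately show "of_bool (Vert 1 (2 * k) \<in> M) + of_bool (Vert 1 (2 * k + 1) \<in> M) =
        1 - (of_bool (Horiz 0 (2 * k) \<in> M) + of_bool (Horiz 0 (2 * k + 1) \<in> M) :: int)"
      by (cases "Horiz 0 (2 * k) \<in> M"; cases "Horiz 0 (2 * k + 1) \<in> M";
          cases "Vert 1 (2 * k + 1) \<in> M") simp_all
  qed simp
  also have "\<dots> = int m - (\<Sum>j<2 * m. of_bool (Horiz 0 j \<in> M))"
    by (simp add: sum_subtractf sum_lessThan_double)
  also have "(\<Sum>j<2 * m. of_bool (Horiz 0 j \<in> M)) = int (card {j. Horiz 0 j \<in> M})"
  proof -
    have "{j. Horiz 0 j \<in> M} = {..<2 * m} \<inter> {j. Horiz 0 j \<in> M}"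
      using sub n by auto
    then show ?thesis by (metis finite_lessThan of_nat_id sum_of_bool_eq)
  qed
  finally show ?thesis by (simp add: m_def)
qed

text \<open>The two nodes of a column see the same vertical edge, so agreement of the rows on the
  left of a column carries over to its right. Zero w-weight gives agreement at \<open>n - 1\<close>,
  to the left of column 0, where the induction starts.\<close>

lemma rows_eq:
  assumes "n \<ge> 2" "even n" and M: "perfect_matching n (hexagons_edges n) M" and "w_weight n M = 0"
    and "j < n"
  shows "Horiz 0 j \<in> M \<longleftrightarrow> Horiz 1 j \<in> M"
proof -
  have sub: "M \<subseteq> hexagons_edges n"
    and one: "\<And>r j. r < 2 \<Longrightarrow> j < n \<Longrightarrow> of_bool (Horiz r j \<in> M)
      + of_bool (Horiz r (previous n j) \<in> M) + of_bool (Vert (j mod 2) j \<in> M) = (1::nat)"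
    using M unfolding perfect_matching_hexagons_iff[OF assms(1)] by simp_all
  have step: "Horiz 0 j \<in> M \<longleftrightarrow> Horiz 1 j \<in> M"
    if "j < n" "Horiz 0 (previous n j) \<in> M \<longleftrightarrow> Horiz 1 (previous n j) \<in> M" for j
    using one[OF _ that(1), of 0] one[OF _ that(1), of 1] that(2)
    by (cases "Horiz 0 j \<in> M"; cases "Horiz 1 j \<in> M"; cases "Vert (j mod 2) j \<in> M") simp_all
  show ?thesis
    using \<open>j < n\<close>
  proof (induction j)
    case 0
    then show ?case
      using step[of 0] w_weight_eq_0_iff[OF assms(1,2) sub] assms(4) by (simp add: previous_def)
  next
    case (Suc j)
    then show ?case using step[of "Suc j"] by (simp add: previous_def)
  qed
qed

section \<open>The bijection between cyclic sparse sets and matchings\<close>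

lemma cyclic_sparse_iff_previous:
  assumes "T \<subseteq> {..<n}"
  shows "(\<forall>j\<in>T. Suc j mod n \<notin> T) \<longleftrightarrow> (\<forall>j\<in>T. previous n j \<notin> T)"
proof -
  have "Suc i mod n = j \<longleftrightarrow> i = previous n j" if "i \<in> T" "j \<in> T" for i j
    using that assms by (intro Suc_mod_eq_iff_previous) auto
  then show ?thesis by metis
qed

lemma parallel_matching_perfect:
  assumes "n \<ge> 2" and T: "T \<in> cyclic_sparse_sets n p"
  shows "perfect_matching n (hexagons_edges n) (parallel_matching n T)"
proof -
  have "T \<subseteq> {..<n}" "\<forall>j\<in>T. previous n j \<notin> T"
    using T cyclic_sparse_iff_previous[of T n] by (auto simp: cyclic_sparse_sets_def)
  moreover have "parallel_matching n T \<subseteq> hexagons_edges n"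
    using \<open>T \<subseteq> {..<n}\<close> by (auto simp: parallel_matching_def)
  ultimately show ?thesis
    unfolding perfect_matching_hexagons_iff[OF assms(1)] by (auto simp: of_bool_def)
qed

lemma bij_betw_hexagon_matchings:
  assumes "n \<ge> 2" "even n"
  shows "bij_betw (parallel_matching n) (cyclic_sparse_sets n p)
           (hexagon_matchings n (int (n div 2) - int p) 0)"
\<comment> \<open>The inverse reads off the bottom row only; by \<open>rows_eq\<close> the top row
  carries no further information.\<close>
proof (rule bij_betw_byWitness[where f' = "\<lambda>M. {j. Horiz 0 j \<in> M}"])
  show "\<forall>T\<in>cyclic_sparse_sets n p. {j. Horiz 0 j \<in> parallel_matching n T} = T"
    by simp
next
  show "parallel_matching n ` cyclic_sparse_sets n p
      \<subseteq> hexagon_matchings n (int (n div 2) - int p) 0"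
  proof (rule image_subsetI)
    fix T assume T: "T \<in> cyclic_sparse_sets n p"
    note perfect = parallel_matching_perfect[OF assms(1) T]
    then have "parallel_matching n T \<subseteq> hexagons_edges n"
      by (simp add: perfect_matching_def)
    then have "w_weight n (parallel_matching n T) = 0"
      by (simp add: w_weight_eq_0_iff[OF assms])
    moreover have "z_weight (parallel_matching n T) = int (n div 2) - int p"
      using z_weight_hexagons[OF assms perfect] T by (simp add: cyclic_sparse_sets_def)
    ultimately show "parallel_matching n T \<in> hexagon_matchings n (int (n div 2) - int p) 0"
      using perfect by (simp add: hexagon_matchings_def)
  qed
next
  have main: "{j. Horiz 0 j \<in> M} \<in> cyclic_sparse_sets n p \<and>
      parallel_matching n {j. Horiz 0 j \<in> M} = M"
    if "M \<in> hexagon_matchings n (int (n div 2) - int p) 0" for M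
  proof -
    have M: "perfect_matching n (hexagons_edges n) M" and z: "z_weight M = int (n div 2) - int p"
      and w: "w_weight n M = 0"
      using that by (auto simp: hexagon_matchings_def)
    then have sub: "M \<subseteq> hexagons_edges n"
      and one: "\<And>j. j < n \<Longrightarrow> of_bool (Horiz 0 j \<in> M)
        + of_bool (Horiz 0 (previous n j) \<in> M) + of_bool (Vert (j mod 2) j \<in> M) = (1::nat)"
      unfolding perfect_matching_hexagons_iff[OF assms(1)] by simp_all
    let ?T = "{j. Horiz 0 j \<in> M}"
    have T: "?T \<subseteq> {..<n}" using sub by auto
    have "previous n j \<notin> ?T" if "j \<in> ?T" for j
      using one[of j] that T by (auto simp: of_bool_def split: if_splits)
    \<comment> \<open>Comparing the prescribed z-weight with \<open>z_weight_hexagons\<close> forces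
      \<open>card ?T = p\<close>.\<close>
    then have "?T \<in> cyclic_sparse_sets n p"
      using T z z_weight_hexagons[OF assms M] cyclic_sparse_iff_previous[OF T]
      by (simp add: cyclic_sparse_sets_def)
    moreover have "e \<in> parallel_matching n ?T \<longleftrightarrow> e \<in> M" for e
    proof (cases e)
      case (Horiz r j)
      have "Horiz r j \<in> M \<longleftrightarrow> r < 2 \<and> Horiz 0 j \<in> M"
        using sub rows_eq[OF assms M w, of j] by (auto simp: less_2_cases_iff)
      then show ?thesis using Horiz by simp
    next
      case (Vert r j)
      have "Vert r j \<in> M \<longleftrightarrow> r = j mod 2 \<and> j < n \<and> Horiz 0 j \<notin> M \<and> Horiz 0 (previous n j) \<notin> M"
        using sub one[of j] by (auto simp: of_bool_def split: if_splits)
      then show ?thesis using Vert by simp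
    qed
    ultimately show ?thesis by blast
  qed
  show "\<forall>M\<in>hexagon_matchings n (int (n div 2) - int p) 0.
      parallel_matching n {j. Horiz 0 j \<in> M} = M"
    using main by blast
  show "(\<lambda>M. {j. Horiz 0 j \<in> M}) ` hexagon_matchings n (int (n div 2) - int p) 0
      \<subseteq> cyclic_sparse_sets n p"
    using main by blast
qed

section \<open>The closed forms\<close>

lemma binomial_div_eq_prod:
  assumes "p \<ge> 1" "2 * p \<le> n"
  shows "real n / (real n - real p) * real ((n - p) choose p) =
           real n / fact p * (\<Prod>q = 1..p - 1. real n - real p - real q)"
proof -
  have "real ((n - p) choose p) = (\<Prod>q = 0..<p. real (n - p) - real q) / fact p"
    unfolding binomial_gbinomial gbinomial_prod_rev ..
  \<comment> \<open>The factor at \<open>q = 0\<close> is n - p, which is positive and cancels the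
    denominator; for \<open>p = 1\<close> the remaining product is empty.\<close>
  also have "(\<Prod>q = 0..<p. real (n - p) - real q) =
      (real n - real p) * (\<Prod>q = 1..p - 1. real n - real p - real q)"
  proof -
    have "{0..<p} = insert 0 {1..p - 1}" using assms by auto
    then show ?thesis using assms by (simp add: of_nat_diff)
  qed
  finally show ?thesis using assms by simp
qed

theorem mainTheorem1:
  fixes n p :: nat
  assumes "n \<ge> 2" and "even n" and "p \<le> n div 2"
  shows "real (card (hexagon_matchings n (int (n div 2) - int p) 0)) =
           real n / (real n - real p) * real ((n - p) choose p) \<and>
         (p \<ge> 1 \<longrightarrow>
           real (card (hexagon_matchings n (int (n div 2) - int p) 0)) =
             real n / fact p * (\<Prod>q = 1..p - 1. real n - real p - real q))"
proof -
  have "real (card (hexagon_matchings n (int (n div 2) - int p) 0)) =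
      real n / (real n - real p) * real ((n - p) choose p)"
    using bij_betw_same_card[OF bij_betw_hexagon_matchings[OF assms(1,2), of p]]
      card_cyclic_sparse_sets[OF assms(1,3)] by simp
  moreover have "2 * p \<le> n" using assms(3) by linarith
  ultimately show ?thesis using binomial_div_eq_prod[of p n] by metis
qed

end
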